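(* Let $X_i$ be a real random variable with probability density function (pdf) $f_i$ on $\mathbb{R}$, let $V_{\mathrm{per},i}$ be a given real number (the prescribed perturbed variance), and set, for $\boldsymbol{\lambda}=(\lambda_1,\lambda_2)^T\in\mathbb{R}^2$, $$\psi_i(\boldsymbol{\lambda})=\log\int_{\mathbb{R}} f_i(x)\exp(\lambda_1 x+\lambda_2x^2)\,dx,$$ where the integral can be finite or infinite (with $\psi_i(\boldsymbol{\lambda})=+\infty$ in the latter case), and $\mathrm{Dom}\,\psi_i=\{\boldsymbol{\lambda}\in\mathbb{R}^2:\psi_i(\boldsymbol{\lambda})<+\infty\}$. Consider the variance-shift constraints on a pdf $f_{\mathrm{mod}}$: $$\int x\,f_{\mathrm{mod}}(x)\,dx=\mathbb{E}[X_i],\qquad \int x^2f_{\mathrm{mod}}(x)\,dx=V_{\mathrm{per},i}+\mathbb{E}[X_i]^2. \qquad (\mathrm{C})$$ Assume that there exists at least one pdf $f_m$ satisfying (C) and that $\mathrm{Dom}\,\psi_i$ is an open set. Then the optimal perturbed density, i.e. the solution $f_{i\delta_i}$ of the problem of minimizing $KL(f_{\mathrm{mod}},f_i)$ over the pdfs $f_{\mathrm{mod}}$ satisfying (C), is $$f_{i\delta_i}(x)=\exp\big(\lambda_1^* x+\lambda_2^*x^2-\psi_i(\boldsymbol{\lambda}^* )\big)f_i(x),$$ where $\boldsymbol{\lambda}^*=(\lambda_1^*,\lambda_2^* )^T$ and $\lambda_1^*$, $\lambda_2^*$ are such that (C) holds for $f_{\mathrm{mod}}=f_{i\delta_i}$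.
   Context: For two pdfs $p,q$ on $\mathbb{R}$, the Kullback-Leibler divergence is $KL(p,q)=\int_{-\infty}^{+\infty}p(y)\log\frac{p(y)}{q(y)}\,dy$ if $\log\frac{p(y)}{q(y)}\in L^1(p(y)dy)$. Here $f_i$ is the original density of the input $X_i$, and $f_{i\delta_i}$ is the density of the perturbed input, which has the same expectation $\mathbb{E}[X_i]$ as the original one and the perturbed variance $V_{\mathrm{per},i}=\mathrm{Var}[X_i]\pm\delta_i$, where $\delta_i$ is the size of the perturbation.
   Formalization: Existence of the solution and of λ* is asserted only if some pdf satisfying (C) has a defined KL divergence to f_i; merely having a pdf satisfying (C) is not enough (f_i uniform on [0,1], variance 10, f_m normal). Equality of densities is almost everywhere. *)

theory Defs
  imports "HOL-Probability.Probability"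
begin

definition is_pdf :: "(real \<Rightarrow> real) \<Rightarrow> bool" where
  "is_pdf f \<longleftrightarrow> f \<in> borel_measurable borel \<and> (\<forall>x. 0 \<le> f x) \<and>
     (\<integral>\<^sup>+x. ennreal (f x) \<partial>lborel) = 1"

text \<open>\<open>KL_defined p q\<close> says that log (p / q) is in L1(p(y)dy). Since \<open>p y / 0 = 0\<close> and
  \<open>ln 0 = 0\<close> in HOL, finiteness of the logarithm p-almost everywhere is a separate conjunct:
  \<open>p\<close> puts no mass on the zero set of \<open>q\<close>.\<close>

definition KL_defined :: "(real \<Rightarrow> real) \<Rightarrow> (real \<Rightarrow> real) \<Rightarrow> bool" where
  "KL_defined p q \<longleftrightarrow>
     (AE y in density lborel (\<lambda>y. ennreal (p y)). q y \<noteq> 0) \<and>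
     integrable (density lborel (\<lambda>y. ennreal (p y))) (\<lambda>y. ln (p y / q y))"

text \<open>The library's \<open>KL_divergence\<close> takes the reference measure first. The value is meaningful
  only under \<open>KL_defined p q\<close>; see \<open>KL_eq_integral\<close> for the formula in terms of densities.\<close>

definition KL :: "(real \<Rightarrow> real) \<Rightarrow> (real \<Rightarrow> real) \<Rightarrow> real" where
  "KL p q = KL_divergence (exp 1) (density lborel (\<lambda>y. ennreal (q y)))
                                  (density lborel (\<lambda>y. ennreal (p y)))"

lemma KL_eq_integral:
  assumes p: "is_pdf p" and q: "is_pdf q" and d: "KL_defined p q"
  shows "KL p q = (LINT y|lborel. p y * ln (p y / q y))"
proof -
  have [measurable]: "p \<in> borel_measurable borel" "q \<in> borel_measurable borel"
    and nn: "\<And>y. 0 \<le> p y" "\<And>y. 0 \<le> q y"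
    using p q by (auto simp: is_pdf_def)
  have "AE y in lborel. 0 < ennreal (p y) \<longrightarrow> q y \<noteq> 0"
    using d by (simp add: KL_defined_def AE_density)
  then have "AE y in lborel. q y = 0 \<longrightarrow> p y = 0"
    by eventually_elim (use nn in \<open>auto simp: order.order_iff_strict\<close>)
  then show ?thesis
    unfolding KL_def
    by (subst lborel.KL_density_density) (auto simp: nn log_def)
qed

text \<open>The constraints: mean \<open>m\<close> and variance \<open>v\<close>.\<close>

definition variance_shift :: "real \<Rightarrow> real \<Rightarrow> (real \<Rightarrow> real) \<Rightarrow> bool" where
  "variance_shift m v g \<longleftrightarrow>
     has_bochner_integral lborel (\<lambda>x. x * g x) m \<and>
     has_bochner_integral lborel (\<lambda>x. x\<^sup>2 * g x) (v + m\<^sup>2)"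

text \<open>The competitors of the minimization problem: the objective has to be defined at \<open>g\<close>.\<close>

definition feasible :: "(real \<Rightarrow> real) \<Rightarrow> real \<Rightarrow> real \<Rightarrow> (real \<Rightarrow> real) \<Rightarrow> bool" where
  "feasible f m v g \<longleftrightarrow> is_pdf g \<and> variance_shift m v g \<and> KL_defined g f"

definition optimal_density :: "(real \<Rightarrow> real) \<Rightarrow> real \<Rightarrow> real \<Rightarrow> (real \<Rightarrow> real) \<Rightarrow> bool" where
  "optimal_density f m v g \<longleftrightarrow>
     feasible f m v g \<and> (\<forall>h. feasible f m v h \<longrightarrow> KL g f \<le> KL h f)"

definition laplace :: "(real \<Rightarrow> real) \<Rightarrow> real \<times> real \<Rightarrow> ennreal" where
  "laplace f l = (\<integral>\<^sup>+x. ennreal (f x * exp (fst l * x + snd l * x\<^sup>2)) \<partial>lborel)"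

text \<open>For a pdf \<open>f\<close> the integral is positive, so the value log 0 does not arise.\<close>

definition psi :: "(real \<Rightarrow> real) \<Rightarrow> real \<times> real \<Rightarrow> ereal" where
  "psi f l = (if laplace f l = \<infinity> then \<infinity> else ereal (ln (enn2real (laplace f l))))"

definition Dom_psi :: "(real \<Rightarrow> real) \<Rightarrow> (real \<times> real) set" where
  "Dom_psi f = {l. psi f l < \<infinity>}"

text \<open>Meaningful only for \<open>l \<in> Dom_psi f\<close>, because \<open>real_of_ereal \<infinity> = 0\<close>.\<close>

definition tilted :: "(real \<Rightarrow> real) \<Rightarrow> real \<times> real \<Rightarrow> real \<Rightarrow> real" where
  "tilted f l x = exp (fst l * x + snd l * x\<^sup>2 - real_of_ereal (psi f l)) * f x"

end

theory Submission
  imports Defs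
begin

text \<open>For \<open>l\<close> in the domain of \<open>\<psi>\<close> and any competitor \<open>h\<close>, Gibbs' inequality against the tilted
  density gives \<open>KL h f \<ge> l \<bullet> c - \<psi> l\<close>, where \<open>c\<close> is the pair of prescribed moments, with equality
  exactly for \<open>h = tilted f l\<close> almost everywhere. So a tilted density that satisfies the
  constraints is the unique optimum, and only the existence of \<open>l\<close> remains. Minimize
  \<open>Z l = exp (\<psi> l - l \<bullet> c)\<close>, the integral of \<open>exp (l \<bullet> (T - c))\<close> against \<open>f\<close> with
  \<open>T x = (x, x\<^sup>2)\<close>. A competitor \<open>h\<close> is absolutely continuous with respect to \<open>f\<close> and satisfies
  \<open>\<integral> u \<bullet> (T - c) h = 0\<close>, so \<open>u \<bullet> (T - c)\<close> is positive on a set of positive \<open>f\<close>-mass for every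
  \<open>u \<noteq> 0\<close>; by Fatou's lemma the sublevel sets of \<open>Z\<close> are then compact and the minimum is attained.
  Since the domain is open, the minimizer is an interior point, and the vanishing of the
  gradient of \<open>Z\<close> there is the moment constraint.\<close>

section \<open>Attainment of the minimum of an exponential integral\<close>

text \<open>Fatou's lemma applies because the integrand is continuous in the parameter. The bound
  \<open>C n\<close> may vary, so that the values along a minimizing sequence can be
  inserted.\<close>

lemma nn_integral_exp_inner_lsc:
  fixes T :: "'a \<Rightarrow> 'b::euclidean_space"
  assumes [measurable]: "T \<in> borel_measurable M" and "u \<longlonglongrightarrow> v"
    and "\<And>n. (\<integral>\<^sup>+x. ennreal (exp (u n \<bullet> T x)) \<partial>M) \<le> C n" and "C \<longlonglongrightarrow> c"
  shows "(\<integral>\<^sup>+x. ennreal (exp (v \<bullet> T x)) \<partial>M) \<le> c"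
proof -
  have "(\<lambda>n. ennreal (exp (u n \<bullet> T x))) \<longlonglongrightarrow> ennreal (exp (v \<bullet> T x))" for x
    by (intro tendsto_intros assms)
  then have "(\<integral>\<^sup>+x. ennreal (exp (v \<bullet> T x)) \<partial>M) =
      (\<integral>\<^sup>+x. liminf (\<lambda>n. ennreal (exp (u n \<bullet> T x))) \<partial>M)"
    by (intro nn_integral_cong lim_imp_Liminf[symmetric]) auto
  also have "\<dots> \<le> liminf (\<lambda>n. \<integral>\<^sup>+x. ennreal (exp (u n \<bullet> T x)) \<partial>M)"
    by (rule nn_integral_liminf) measurable
  also have "\<dots> \<le> liminf C"
    by (intro Liminf_mono always_eventually allI assms)
  also have "\<dots> = c"
    by (intro lim_imp_Liminf assms) auto
  finally show ?thesis .
qed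

text \<open>Along parameters whose norm tends to infinity, a subsequence of the directions converges
  to some \<open>v\<close>. The integrand explodes wherever \<open>v \<bullet> T x\<close> is
  positive, by \<open>nd\<close> not a null set, and Fatou's lemma contradicts the finite
  bound.\<close>

lemma nn_integral_exp_inner_sublevel_bounded:
  fixes T :: "'a \<Rightarrow> 'b::euclidean_space"
  assumes [measurable]: "T \<in> borel_measurable M"
    and nd: "\<And>v. v \<noteq> 0 \<Longrightarrow> \<not> (AE x in M. v \<bullet> T x \<le> 0)"
    and c: "c < \<infinity>"
  shows "bounded {u. (\<integral>\<^sup>+x. ennreal (exp (u \<bullet> T x)) \<partial>M) \<le> c}" (is "bounded ?S")
proof (rule ccontr)
  assume nb: "\<not> bounded ?S"
  have "\<exists>u\<in>?S. norm u > real n" for n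
    using nb unfolding bounded_iff by (meson not_le)
  then obtain u where u: "\<And>n. u n \<in> ?S" "\<And>n. norm (u n) > real n"
    by metis
  have "\<forall>n. sgn (u n) \<in> sphere 0 1"
  proof
    fix n
    have "u n \<noteq> 0" using u(2)[of n] by auto
    then show "sgn (u n) \<in> sphere 0 1" by (simp add: norm_sgn)
  qed
  then obtain v r where v: "v \<in> sphere 0 1" and r: "strict_mono r"
      and lim: "((\<lambda>n. sgn (u n)) \<circ> r) \<longlonglongrightarrow> v"
    using compact_sphere[of "0::'b" 1] unfolding compact_def by metis
  have "v \<noteq> 0" using v by auto
  have norm_lim: "filterlim (\<lambda>n. norm (u (r n))) at_top sequentially"
  proof (rule filterlim_at_top_mono[OF filterlim_real_sequentially])
    show "\<forall>\<^sub>F n in sequentially. real n \<le> norm (u (r n))"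
      using u(2) seq_suble[OF r] by (intro always_eventually allI) (meson less_imp_le of_nat_mono order.trans)
  qed
  have top_le: "\<infinity> * indicator {x \<in> space M. 0 < v \<bullet> T x} x
      \<le> liminf (\<lambda>n. ennreal (exp (u (r n) \<bullet> T x)))" for x
  proof (cases "0 < v \<bullet> T x")
    case True
    \<comment> \<open>Splitting \<open>u (r n)\<close> into direction and norm gives a factor with
      positive limit times a factor that diverges.\<close>
    have "filterlim (\<lambda>n. (sgn (u (r n)) \<bullet> T x) * norm (u (r n))) at_top sequentially"
      using lim by (intro filterlim_tendsto_pos_mult_at_top[OF _ True norm_lim] tendsto_intros)
        (simp add: o_def)
    moreover have "(sgn (u (r n)) \<bullet> T x) * norm (u (r n)) = u (r n) \<bullet> T x" for n
      by (cases "u (r n) = 0") (auto simp: sgn_div_norm)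
    ultimately have "filterlim (\<lambda>n. exp (u (r n) \<bullet> T x)) at_top sequentially"
      by (intro filterlim_compose[OF exp_at_top]) simp
    then have "(\<lambda>n. ennreal (exp (u (r n) \<bullet> T x))) \<longlonglongrightarrow> \<infinity>"
      by (simp add: ennreal_tendsto_top_eq_at_top)
    then have "liminf (\<lambda>n. ennreal (exp (u (r n) \<bullet> T x))) = \<infinity>"
      by (intro lim_imp_Liminf) auto
    then show ?thesis by simp
  qed simp
  have "\<infinity> * emeasure M {x \<in> space M. 0 < v \<bullet> T x} =
      (\<integral>\<^sup>+x. \<infinity> * indicator {x \<in> space M. 0 < v \<bullet> T x} x \<partial>M)"
    by (subst nn_integral_cmult_indicator) auto
  also have "\<dots> \<le> (\<integral>\<^sup>+x. liminf (\<lambda>n. ennreal (exp (u (r n) \<bullet> T x))) \<partial>M)"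
    by (intro nn_integral_mono top_le)
  also have "\<dots> \<le> liminf (\<lambda>n. \<integral>\<^sup>+x. ennreal (exp (u (r n) \<bullet> T x)) \<partial>M)"
    by (rule nn_integral_liminf) measurable
  also have "\<dots> \<le> liminf (\<lambda>n. c)"
    using u(1) by (intro Liminf_mono always_eventually) auto
  also have "\<dots> < \<infinity>" using c by (simp add: Liminf_const)
  \<comment> \<open>In \<open>ennreal\<close>, \<open>\<infinity>\<close> times a nonzero value is
    \<open>\<infinity>\<close>, so the finite bound forces the set to be null.\<close>
  finally have "emeasure M {x \<in> space M. 0 < v \<bullet> T x} = 0"
    by (metis ennreal_top_mult infinity_ennreal_def less_irrefl)
  then have "AE x in M. v \<bullet> T x \<le> 0"
    by (subst AE_iff_measurable[OF _ refl]) (auto simp: not_le)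
  with nd[OF \<open>v \<noteq> 0\<close>] show False by simp
qed

text \<open>Direct method: a minimizing sequence is bounded, and lower semicontinuity carries the
  infimum to a limit point. If the infimum is infinite, any point serves.\<close>

lemma nn_integral_exp_inner_attains_min:
  fixes T :: "'a \<Rightarrow> 'b::euclidean_space"
  assumes [measurable]: "T \<in> borel_measurable M"
    and nd: "\<And>v. v \<noteq> 0 \<Longrightarrow> \<not> (AE x in M. v \<bullet> T x \<le> 0)"
  obtains u where "\<And>v. (\<integral>\<^sup>+x. ennreal (exp (u \<bullet> T x)) \<partial>M) \<le> (\<integral>\<^sup>+x. ennreal (exp (v \<bullet> T x)) \<partial>M)"
proof -
  define Z where "Z u = (\<integral>\<^sup>+x. ennreal (exp (u \<bullet> T x)) \<partial>M)" for u
  define L where "L = Inf (range Z)"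
  have L_le: "L \<le> Z v" for v unfolding L_def by (rule Inf_lower) simp
  have "\<exists>u. Z u \<le> L"
  proof (cases "L = \<infinity>")
    case False
    then have Lf: "L < \<infinity>" by (simp add: less_top)
    obtain a where a: "decseq a" "range a \<subseteq> range Z" "L = (INF i. a i)"
      using ennreal_Inf_countable_INF[of "range Z"] unfolding L_def by auto
    have alim: "a \<longlonglongrightarrow> L" using LIMSEQ_INF[OF a(1)] a(3) by simp
    have "\<forall>n. \<exists>w. a n = Z w" using a(2) by blast
    then obtain w where w: "\<And>n. a n = Z (w n)" by metis
    have "\<forall>\<^sub>F n in sequentially. a n < \<infinity>" using order_tendstoD(2)[OF alim Lf] .
    then obtain N where N: "a N < \<infinity>" by (auto simp: eventually_sequentially)
    \<comment> \<open>From index \<open>N\<close> on, the decreasing values keep the sequence inside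
      one sublevel set of finite level.\<close>
    have "w (n + N) \<in> {u. Z u \<le> a N}" for n
      using a(1) by (simp add: w[symmetric] decseqD)
    moreover have "bounded {u. Z u \<le> a N}"
      unfolding Z_def by (rule nn_integral_exp_inner_sublevel_bounded[OF assms N])
    ultimately have "bounded (range (\<lambda>n. w (n + N)))"
      by (meson bounded_subset image_subsetI)
    from bounded_imp_convergent_subsequence[OF this] obtain v r
      where r: "strict_mono r" and v: "((\<lambda>n. w (n + N)) \<circ> r) \<longlonglongrightarrow> v" by auto
    have alim': "(\<lambda>n. a (r n + N)) \<longlonglongrightarrow> L"
      using LIMSEQ_subseq_LIMSEQ[OF LIMSEQ_ignore_initial_segment[OF alim, of N] r]
      by (simp add: o_def)
    have "Z v \<le> L"
      unfolding Z_def
      by (rule nn_integral_exp_inner_lsc[OF assms(1) v _ alim']) (simp add: w Z_def)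
    then show ?thesis ..
  qed simp
  then show ?thesis using that L_le unfolding Z_def by (meson order.trans)
qed

section \<open>First-order condition at a minimizer\<close>

text \<open>The Taylor remainder is \<open>exp t * (s * z)^2 / 2\<close> with
  \<open>|t| \<le> |z| / 2\<close>. The other half of the exponent absorbs \<open>z^2\<close>, so
  the bound is integrable as soon as \<open>exp z\<close> and \<open>exp (- z)\<close> are.\<close>

lemma exp_mult_le_quadratic:
  fixes s z :: real
  assumes "\<bar>s\<bar> \<le> 1/2"
  shows "exp (s * z) \<le> 1 + s * z + 4 * s\<^sup>2 * (exp z + exp (- z))"
proof -
  obtain t where t: "\<bar>t\<bar> \<le> \<bar>s * z\<bar>"
    "exp (s * z) = (\<Sum>m<2. (s * z) ^ m / fact m) + exp t / fact 2 * (s * z)\<^sup>2"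
    using Maclaurin_exp_le[of "s * z" 2] by blast
  have "\<bar>s * z\<bar> \<le> \<bar>z\<bar> / 2" using mult_right_mono[OF assms, of "\<bar>z\<bar>"] by (simp add: abs_mult)
  then have "exp t \<le> exp (\<bar>z\<bar> / 2)" using t(1) by simp
  moreover have "(\<bar>z\<bar> / 2)\<^sup>2 / 2 \<le> exp (\<bar>z\<bar> / 2)"
    using exp_lower_Taylor_quadratic[of "\<bar>z\<bar> / 2"] by (simp add: algebra_simps)
  then have "z\<^sup>2 \<le> 8 * exp (\<bar>z\<bar> / 2)" by (simp add: power_divide)
  ultimately have "exp t * z\<^sup>2 \<le> exp (\<bar>z\<bar> / 2) * (8 * exp (\<bar>z\<bar> / 2))"
    by (intro mult_mono) auto
  also have "\<dots> = 8 * exp \<bar>z\<bar>" by (simp add: exp_add[symmetric])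
  also have "\<dots> \<le> 8 * (exp z + exp (- z))" by (simp add: abs_if)
  finally have "s\<^sup>2 * (exp t * z\<^sup>2) \<le> s\<^sup>2 * (8 * (exp z + exp (- z)))"
    by (intro mult_left_mono) auto
  then show ?thesis using t(2) by (simp add: numeral_2_eq_2 power_mult_distrib algebra_simps)
qed

text \<open>The quadratic bound, integrated, gives \<open>0 \<le> s d I + 4 s\<^sup>2 K\<close> for all small \<open>s\<close> of either sign,
  which replaces differentiation under the integral.\<close>

lemma exp_moment_stationary:
  fixes w :: "'a \<Rightarrow> real"
  assumes [measurable]: "w \<in> borel_measurable M"
    and d: "d > 0" "integrable M (\<lambda>x. exp (d * w x))" "integrable M (\<lambda>x. exp (- d * w x))"
    and min: "\<And>s. emeasure M (space M) \<le> (\<integral>\<^sup>+x. ennreal (exp (s * w x)) \<partial>M)"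
  shows "has_bochner_integral M w 0"
proof -
  \<comment> \<open>\<open>k\<close> dominates both \<open>1\<close> and \<open>d * |w x|\<close>,
    so its integrability makes the measure finite and \<open>w\<close> integrable.\<close>
  define k where "k x = exp (d * w x) + exp (- d * w x)" for x
  have k: "integrable M k" using d(2,3) unfolding k_def by auto
  have k1: "1 \<le> k x" for x
    using exp_ge_add_one_self[of "d * w x"] exp_ge_add_one_self[of "- d * w x"] unfolding k_def by linarith
  have "\<bar>y\<bar> \<le> exp y + exp (- y)" for y :: real
    using exp_ge_add_one_self[of y] exp_ge_add_one_self[of "- y"] exp_gt_zero[of y] exp_gt_zero[of "- y"]
    by linarith
  then have kw: "d * \<bar>w x\<bar> \<le> k x" for x
    using d(1) unfolding k_def by (metis abs_mult abs_of_pos minus_mult_left)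
  have one: "integrable M (\<lambda>x. 1::real)"
    by (rule Bochner_Integration.integrable_bound[OF k]) (use k1 in \<open>auto intro!: AE_I2 order.trans[OF _ abs_ge_self]\<close>)
  have "integrable M (\<lambda>x. d * w x)"
    by (rule Bochner_Integration.integrable_bound[OF k])
      (use kw d(1) in \<open>auto intro!: AE_I2 order.trans[OF _ abs_ge_self] simp: abs_mult\<close>)
  then have w: "integrable M w" using d(1) by simp
  have fin: "emeasure M (space M) < \<infinity>" using one d(1) by (simp add: integrable_iff_bounded)
  define I K where "I = (LINT x|M. w x)" and "K = (LINT x|M. k x)"
  have bound: "0 \<le> s * (d * I) + 4 * s\<^sup>2 * K" if s: "\<bar>s\<bar> \<le> 1/2" for s
  proof -
    have le: "exp ((s * d) * w x) \<le> 1 + s * (d * w x) + 4 * s\<^sup>2 * k x" for x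
      using exp_mult_le_quadratic[OF s, of "d * w x"] unfolding k_def by (simp add: mult_ac)
    have int: "integrable M (\<lambda>x. 1 + s * (d * w x) + 4 * s\<^sup>2 * k x)"
      by (intro Bochner_Integration.integrable_add one integrable_mult_right w k)
    have nonneg: "0 \<le> 1 + s * (d * w x) + 4 * s\<^sup>2 * k x" for x
      using le[of x] exp_gt_zero[of "(s * d) * w x"] by linarith
    have "emeasure M (space M) \<le> (\<integral>\<^sup>+x. ennreal (exp ((s * d) * w x)) \<partial>M)" by (rule min)
    also have "\<dots> \<le> (\<integral>\<^sup>+x. ennreal (1 + s * (d * w x) + 4 * s\<^sup>2 * k x) \<partial>M)"
      by (intro nn_integral_mono ennreal_leI le)
    also have "\<dots> = ennreal (LINT x|M. 1 + s * (d * w x) + 4 * s\<^sup>2 * k x)"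
      by (intro nn_integral_eq_integral int AE_I2 nonneg)
    also have "(LINT x|M. 1 + s * (d * w x) + 4 * s\<^sup>2 * k x) = measure M (space M) + s * (d * I) + 4 * s\<^sup>2 * K"
      using one w k unfolding I_def K_def by simp
    finally have "ennreal (measure M (space M)) \<le> ennreal (measure M (space M) + s * (d * I) + 4 * s\<^sup>2 * K)"
      using fin by (simp add: emeasure_eq_ennreal_measure)
    \<comment> \<open>\<open>ennreal\<close> truncates negative reals to 0, so the sign is settled
      before the comparison is moved to the reals.\<close>
    moreover have "0 \<le> measure M (space M) + s * (d * I) + 4 * s\<^sup>2 * K"
    proof -
      have "0 \<le> (LINT x|M. 1 + s * (d * w x) + 4 * s\<^sup>2 * k x)"
        by (intro Bochner_Integration.integral_nonneg nonneg)
      then show ?thesis using one w k unfolding I_def K_def by simp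
    qed
    ultimately show ?thesis by (simp add: ennreal_le_iff)
  qed
  have "0 \<le> K" unfolding K_def using k1 by (intro Bochner_Integration.integral_nonneg) (meson order.trans zero_le_one)
  have "I = 0"
  proof (rule ccontr)
    assume "I \<noteq> 0"
    define J where "J = d * I"
    have J: "J \<noteq> 0" using \<open>I \<noteq> 0\<close> d(1) by (simp add: J_def)
    \<comment> \<open>The sign of \<open>s\<close> makes the linear term negative. In the
      denominator, \<open>2 * |J|\<close> ensures \<open>|s| \<le> 1/2\<close> and
      \<open>8 * K\<close> lets the linear term beat the quadratic one.\<close>
    define s where "s = - J / (2 * \<bar>J\<bar> + 8 * K)"
    have pos: "2 * \<bar>J\<bar> + 8 * K > 0" using J \<open>0 \<le> K\<close> by (simp add: add_pos_nonneg)
    have "\<bar>s\<bar> \<le> 1/2" unfolding s_def using pos \<open>0 \<le> K\<close> by (simp add: abs_divide divide_simps)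
    from bound[OF this] have "0 \<le> s * J + 4 * s\<^sup>2 * K" by (simp add: J_def)
    also have "\<dots> = J\<^sup>2 * (4 * K - (2 * \<bar>J\<bar> + 8 * K)) / (2 * \<bar>J\<bar> + 8 * K)\<^sup>2"
      unfolding s_def using pos by (simp add: divide_simps power2_eq_square) (simp add: algebra_simps)
    also have "\<dots> < 0"
      using J \<open>0 \<le> K\<close> pos by (intro divide_neg_pos mult_pos_neg) (auto simp: add_nonneg_pos)
    finally show False by simp
  qed
  then show ?thesis using w unfolding I_def by (simp add: has_bochner_integral_iff)
qed

text \<open>Restricting to the line \<open>u + s *\<^sub>R b\<close> and absorbing
  \<open>exp (u \<bullet> T x)\<close> into the measure reduces the claim to the one-dimensional
  case for \<open>b \<bullet> T x\<close>. Openness supplies the exponential moments on both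
  sides.\<close>

lemma exp_inner_moment_stationary:
  fixes M :: "'a measure" and T :: "'a \<Rightarrow> 'b::euclidean_space"
  defines "Z u \<equiv> (\<integral>\<^sup>+x. ennreal (exp (u \<bullet> T x)) \<partial>M)"
  assumes [measurable]: "T \<in> borel_measurable M"
    and op: "open {v. Z v < \<infinity>}" and u: "Z u < \<infinity>" and min: "\<And>v. Z u \<le> Z v"
  shows "has_bochner_integral M (\<lambda>x. exp (u \<bullet> T x) * (b \<bullet> T x)) 0"
proof -
  define N where "N = density M (\<lambda>x. ennreal (exp (u \<bullet> T x)))"
  have [measurable]: "T \<in> borel_measurable N" unfolding N_def by simp
  have Zs: "(\<integral>\<^sup>+x. ennreal (exp (s * (b \<bullet> T x))) \<partial>N) = Z (u + s *\<^sub>R b)" for s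
    unfolding N_def Z_def
    by (subst nn_integral_density)
      (auto simp: ennreal_mult[symmetric] exp_add[symmetric] inner_add_left)
  obtain e where "e > 0" and e: "ball u e \<subseteq> {v. Z v < \<infinity>}"
    using op u by (auto simp: open_contains_ball)
  \<comment> \<open>The summand 1 covers \<open>b = 0\<close> without a case split.\<close>
  define d where "d = e / (1 + norm b)"
  have "d > 0" using \<open>e > 0\<close> by (simp add: d_def add_pos_nonneg)
  have d: "Z (u + s *\<^sub>R b) < \<infinity>" if "\<bar>s\<bar> < d" for s
  proof -
    have "\<bar>s\<bar> * norm b \<le> d * norm b" using that by (intro mult_right_mono) auto
    also have "\<dots> < d * (1 + norm b)" using \<open>d > 0\<close> by simp
    also have "\<dots> = e" by (simp add: d_def add_nonneg_eq_0_iff)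
    finally have "u + s *\<^sub>R b \<in> ball u e" by (simp add: dist_norm)
    with e show ?thesis by auto
  qed
  have int: "integrable N (\<lambda>x. exp (s * (b \<bullet> T x)))" if "\<bar>s\<bar> < d" for s
    using d[OF that] Zs[of s] by (intro integrableI_nonneg) auto
  have "has_bochner_integral N (\<lambda>x. b \<bullet> T x) 0"
  \<comment> \<open>Finiteness is known only for \<open>|s| < d\<close>, hence the half.\<close>
  proof (rule exp_moment_stationary[where d="d/2"])
    show "emeasure N (space N) \<le> (\<integral>\<^sup>+x. ennreal (exp (s * (b \<bullet> T x))) \<partial>N)" for s
      using min[of "u + s *\<^sub>R b"] Zs[of 0] Zs[of s] by simp
  qed (use \<open>d > 0\<close> int[of "d/2"] int[of "-d/2"] in auto)
  then show ?thesis
    unfolding N_def has_bochner_integral_iff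
    by (simp add: integrable_density integral_density)
qed

section \<open>Densities, feasibility and the normalizing integral\<close>

lemma is_pdfD:
  assumes "is_pdf f"
  shows "f \<in> borel_measurable borel" "\<And>x. 0 \<le> f x" "has_bochner_integral lborel f 1"
  using assms unfolding is_pdf_def by (auto intro!: has_bochner_integral_nn_integral)

lemma KL_defined_iff:
  assumes "is_pdf p" "is_pdf q"
  shows "KL_defined p q \<longleftrightarrow>
    (AE x in lborel. q x = 0 \<longrightarrow> p x = 0) \<and> integrable lborel (\<lambda>x. p x * ln (p x / q x))"
proof -
  note [measurable] = assms[THEN is_pdfD(1)] and nn = assms[THEN is_pdfD(2)]
  have "(0 < ennreal (p x) \<longrightarrow> q x \<noteq> 0) = (q x = 0 \<longrightarrow> p x = 0)" for x
    using nn(1)[of x] by (auto simp: order.order_iff_strict)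
  then show ?thesis
    unfolding KL_defined_def by (simp add: AE_density integrable_density nn)
qed

text \<open>Lets every version of the optimal density count as a competitor, since densities matter
  only up to null sets.\<close>

lemma feasible_cong_AE:
  assumes "is_pdf f" "is_pdf g" "feasible f m v h" and ae: "AE x in lborel. g x = h x"
  shows "feasible f m v g"
proof -
  have "is_pdf h" using assms by (simp add: feasible_def)
  note [measurable] = assms(1,2)[THEN is_pdfD(1)] is_pdfD(1)[OF \<open>is_pdf h\<close>]
  have "variance_shift m v g = variance_shift m v h"
    unfolding variance_shift_def using ae
    by (intro arg_cong2[where f="(\<and>)"] has_bochner_integral_cong_AE) auto
  moreover have "(AE x in lborel. f x = 0 \<longrightarrow> g x = 0) = (AE x in lborel. f x = 0 \<longrightarrow> h x = 0)"
    using ae by auto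
  moreover have "integrable lborel (\<lambda>x. g x * ln (g x / f x)) =
      integrable lborel (\<lambda>x. h x * ln (h x / f x))"
    using ae by (intro integrable_cong_AE) auto
  ultimately show ?thesis
    using assms \<open>is_pdf h\<close> by (simp add: feasible_def KL_defined_iff)
qed

lemma Dom_psi_iff: "l \<in> Dom_psi f \<longleftrightarrow> laplace f l < \<infinity>"
  by (simp add: Dom_psi_def psi_def less_top)

text \<open>The exponential never vanishes, so a zero integral would force \<open>f\<close> to
  vanish almost everywhere. This keeps \<open>psi\<close> away from the default value
  \<open>ln 0 = 0\<close>.\<close>

lemma laplace_pos:
  assumes "is_pdf f"
  shows "0 < laplace f l"
proof (rule ccontr)
  note [measurable] = is_pdfD(1)[OF assms]
  assume "\<not> 0 < laplace f l"
  then have "AE x in lborel. ennreal (f x * exp (fst l * x + snd l * x\<^sup>2)) = 0"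
    unfolding laplace_def by (subst (asm) not_gr_zero, subst (asm) nn_integral_0_iff_AE) auto
  then have "AE x in lborel. ennreal (f x) = 0"
    by eventually_elim (auto simp: ennreal_eq_0_iff mult_le_0_iff not_le)
  then have "(\<integral>\<^sup>+x. ennreal (f x) \<partial>lborel) = 0"
    by (subst nn_integral_0_iff_AE) auto
  with assms show False by (simp add: is_pdf_def)
qed

lemma exp_psi:
  assumes "is_pdf f" "l \<in> Dom_psi f"
  shows "ennreal (exp (real_of_ereal (psi f l))) = laplace f l"
  using assms laplace_pos[OF assms(1), of l]
  by (cases "laplace f l") (auto simp: Dom_psi_iff psi_def)

lemma is_pdf_tilted:
  assumes "is_pdf f" "l \<in> Dom_psi f"
  shows "is_pdf (tilted f l)"
proof -
  note [measurable] = is_pdfD(1)[OF assms(1)] and nn = is_pdfD(2)[OF assms(1)]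
  have "(\<integral>\<^sup>+x. ennreal (tilted f l x) \<partial>lborel) =
      (\<integral>\<^sup>+x. ennreal (exp (- real_of_ereal (psi f l))) *
         ennreal (f x * exp (fst l * x + snd l * x\<^sup>2)) \<partial>lborel)"
    using nn by (intro nn_integral_cong)
      (simp add: tilted_def ennreal_mult[symmetric] exp_diff exp_minus field_simps)
  also have "\<dots> = ennreal (exp (- real_of_ereal (psi f l))) * laplace f l"
    unfolding laplace_def by (rule nn_integral_cmult) measurable
  also have "\<dots> = 1"
    by (simp add: exp_psi[OF assms, symmetric] ennreal_mult[symmetric] exp_add[symmetric])
  finally show ?thesis using nn by (simp add: is_pdf_def tilted_def[abs_def])
qed

section \<open>Gibbs' inequality and optimality of tilted densities\<close>

text \<open>The logarithm of \<open>tilted f l x / f x\<close> is a quadratic polynomial where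
  \<open>f x > 0\<close>. Its integral against \<open>h\<close> sees only the prescribed moments, so
  the bound is common to all competitors.\<close>

lemma KL_lower_bound:
  fixes f h :: "real \<Rightarrow> real" and l :: "real \<times> real"
  defines "b m v \<equiv> fst l * m + snd l * (v + m\<^sup>2) - real_of_ereal (psi f l)"
  assumes f: "is_pdf f" and l: "l \<in> Dom_psi f" and h: "feasible f m v h"
  shows "b m v \<le> KL h f" and "KL h f = b m v \<longleftrightarrow> (AE x in lborel. h x = tilted f l x)"
proof -
  have hp: "is_pdf h" and vs: "variance_shift m v h" and d: "KL_defined h f"
    using h by (auto simp: feasible_def)
  note t = is_pdf_tilted[OF f l]
  note [measurable] = f[THEN is_pdfD(1)] hp[THEN is_pdfD(1)] t[THEN is_pdfD(1)]
    and nn = f[THEN is_pdfD(2)] hp[THEN is_pdfD(2)] t[THEN is_pdfD(2)]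
  define q where "q x = fst l * x + snd l * x\<^sup>2 - real_of_ereal (psi f l)" for x
  \<comment> \<open>The terms \<open>- h x + tilted f l x\<close> integrate to 0 and make the
    integrand nonnegative almost everywhere: where \<open>h x > 0\<close> it is
    \<open>h x * (r - 1 - ln r)\<close>, with \<open>r\<close> the ratio of the tilted density to
    \<open>h\<close>. The equality case is then read off pointwise.\<close>
  define D where "D x = h x * ln (h x / f x) - h x * q x - h x + tilted f l x" for x
  have "has_bochner_integral lborel (\<lambda>x. h x * ln (h x / f x)) (KL h f)"
    using d by (simp add: has_bochner_integral_iff KL_eq_integral[OF hp f d] KL_defined_iff[OF hp f])
  moreover have "has_bochner_integral lborel
      (\<lambda>x. fst l * (x * h x) + snd l * (x\<^sup>2 * h x) - real_of_ereal (psi f l) * h x)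
      (fst l * m + snd l * (v + m\<^sup>2) - real_of_ereal (psi f l) * 1)"
    using vs is_pdfD(3)[OF hp] unfolding variance_shift_def
    by (intro has_bochner_integral_add has_bochner_integral_diff has_bochner_integral_mult_right) auto
  then have "has_bochner_integral lborel (\<lambda>x. h x * q x) (b m v)"
    by (simp add: q_def b_def algebra_simps)
  ultimately have "has_bochner_integral lborel D (KL h f - b m v - 1 + 1)"
    unfolding D_def using is_pdfD(3)[OF hp] is_pdfD(3)[OF t]
    by (intro has_bochner_integral_add has_bochner_integral_diff)
  then have D: "integrable lborel D" "(LINT x|lborel. D x) = KL h f - b m v"
    by (auto simp: has_bochner_integral_iff)
  have AE: "AE x in lborel. f x = 0 \<longrightarrow> h x = 0"
    using d by (simp add: KL_defined_iff[OF hp f])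
  have key: "0 \<le> D x \<and> (D x = 0 \<longleftrightarrow> h x = tilted f l x)" if "f x = 0 \<longrightarrow> h x = 0" for x
  proof (cases "h x = 0")
    case True
    then show ?thesis using nn(3)[of x] by (auto simp: D_def)
  next
    case False
    then have pos: "0 < h x" "0 < f x" using that nn(1,2)[of x] by (auto simp: order.order_iff_strict)
    define r where "r = tilted f l x / h x"
    have r: "0 < r" using pos by (simp add: r_def tilted_def)
    have log: "ln (h x / f x) = q x - ln r"
      using pos by (simp add: r_def tilted_def q_def ln_mult ln_div)
    have "tilted f l x = h x * r" using pos by (simp add: r_def)
    then have D: "D x = h x * (r - 1 - ln r)"
      by (simp add: D_def log algebra_simps)
    have "r - 1 - ln r = 0 \<longleftrightarrow> r = 1"
      using ln_eq_minus_one[OF r] by auto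
    then show ?thesis
      using D ln_le_minus_one[OF r] pos by (auto simp: r_def)
  qed
  have D0: "AE x in lborel. 0 \<le> D x" using AE by eventually_elim (use key in blast)
  show "b m v \<le> KL h f" using integral_nonneg_AE[OF D0] D(2) by simp
  have "KL h f = b m v \<longleftrightarrow> (AE x in lborel. D x = 0)"
    using integral_nonneg_eq_0_iff_AE[OF D(1) D0] D(2) by simp
  also have "\<dots> \<longleftrightarrow> (AE x in lborel. h x = tilted f l x)"
  proof
    assume "AE x in lborel. D x = 0"
    with AE show "AE x in lborel. h x = tilted f l x" by eventually_elim (use key in blast)
  next
    assume "AE x in lborel. h x = tilted f l x"
    with AE show "AE x in lborel. D x = 0" by eventually_elim (use key in blast)
  qed
  finally show "KL h f = b m v \<longleftrightarrow> (AE x in lborel. h x = tilted f l x)" .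
qed

text \<open>The log-ratio to \<open>f\<close> is quadratic, so the finite moments already make the
  divergence defined; where \<open>f\<close> vanishes, so does the tilted density.\<close>

lemma feasible_tilted:
  assumes f: "is_pdf f" and l: "l \<in> Dom_psi f" and vs: "variance_shift m v (tilted f l)"
  shows "feasible f m v (tilted f l)"
proof -
  note t = is_pdf_tilted[OF f l]
  define q where "q x = fst l * x + snd l * x\<^sup>2 - real_of_ereal (psi f l)" for x
  have "integrable lborel (\<lambda>x. fst l * (x * tilted f l x) + snd l * (x\<^sup>2 * tilted f l x)
      - real_of_ereal (psi f l) * tilted f l x)"
    using vs is_pdfD(3)[OF t] unfolding variance_shift_def has_bochner_integral_iff
    by (intro Bochner_Integration.integrable_add Bochner_Integration.integrable_diff
        integrable_mult_right) auto
  also have "(\<lambda>x. fst l * (x * tilted f l x) + snd l * (x\<^sup>2 * tilted f l x)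
      - real_of_ereal (psi f l) * tilted f l x) = (\<lambda>x. tilted f l x * ln (tilted f l x / f x))"
  proof
    show "fst l * (x * tilted f l x) + snd l * (x\<^sup>2 * tilted f l x)
      - real_of_ereal (psi f l) * tilted f l x = tilted f l x * ln (tilted f l x / f x)" for x
      by (cases "f x = 0") (simp_all add: tilted_def algebra_simps)
  qed
  finally show ?thesis
    using t vs by (simp add: feasible_def KL_defined_iff[OF t f]) (simp add: tilted_def)
qed

text \<open>The tilted density is a competitor attaining the common lower bound, so optimality
  amounts to equality in Gibbs' inequality.\<close>

lemma optimal_density_iff_tilted:
  assumes f: "is_pdf f" and l: "l \<in> Dom_psi f" and vs: "variance_shift m v (tilted f l)"
  shows "optimal_density f m v g \<longleftrightarrow> is_pdf g \<and> (AE x in lborel. g x = tilted f l x)"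
proof
  note t = feasible_tilted[OF assms]
  assume "optimal_density f m v g"
  then have g: "feasible f m v g" "KL g f \<le> KL (tilted f l) f"
    using t by (auto simp: optimal_density_def)
  have "KL g f = fst l * m + snd l * (v + m\<^sup>2) - real_of_ereal (psi f l)"
    using g KL_lower_bound[OF f l g(1)] KL_lower_bound(2)[OF f l t] by simp
  then show "is_pdf g \<and> (AE x in lborel. g x = tilted f l x)"
    using g KL_lower_bound(2)[OF f l g(1)] by (auto simp: feasible_def)
next
  assume g: "is_pdf g \<and> (AE x in lborel. g x = tilted f l x)"
  then have fg: "feasible f m v g"
    using feasible_cong_AE[OF f _ feasible_tilted[OF assms]] by blast
  then show "optimal_density f m v g"
    using g KL_lower_bound(2)[OF f l fg] KL_lower_bound(1)[OF f l] by (simp add: optimal_density_def)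
qed

section \<open>Existence of the parameter\<close>

text \<open>A nonzero polynomial has finitely many roots. This is the affine independence of
  \<open>x\<close> and \<open>x^2\<close> modulo null sets that makes the moment problem
  nondegenerate.\<close>

lemma AE_quadratic_neq_0:
  fixes a b c :: real
  assumes "(a, b) \<noteq> (0, 0)"
  shows "AE x in lborel. a * x + b * x\<^sup>2 + c \<noteq> 0"
proof -
  have "[:c, a, b:] \<noteq> 0" using assms by auto
  then have "finite {x. poly [:c, a, b:] x = 0}" by (rule poly_roots_finite)
  then have "{x. poly [:c, a, b:] x = 0} \<in> null_sets lborel"
    by (rule finite_imp_null_set_lborel)
  moreover have "{x. poly [:c, a, b:] x = 0} = {x. a * x + b * x\<^sup>2 + c = 0}"
    by (auto simp: power2_eq_square algebra_simps)
  ultimately show ?thesis by (auto intro: AE_I')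
qed

lemma exists_tilted_variance_shift:
  assumes f: "is_pdf f" and h: "feasible f m v h" and op: "open (Dom_psi f)"
  shows "\<exists>l\<in>Dom_psi f. variance_shift m v (tilted f l)"
proof -
  \<comment> \<open>Centring at the prescribed moments turns the constraints into vanishing
    first-order conditions for \<open>Z\<close>.\<close>
  define T where "T x = (x - m, x\<^sup>2 - (v + m\<^sup>2))" for x
  define M where "M = density lborel (\<lambda>x. ennreal (f x))"
  define Z where "Z u = (\<integral>\<^sup>+x. ennreal (exp (u \<bullet> T x)) \<partial>M)" for u
  define k where "k u = fst u * m + snd u * (v + m\<^sup>2)" for u
  have hp: "is_pdf h" and vs: "variance_shift m v h" and d: "KL_defined h f"
    using h by (auto simp: feasible_def)
  note [measurable] = f[THEN is_pdfD(1)] hp[THEN is_pdfD(1)]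
    and nn = f[THEN is_pdfD(2)] hp[THEN is_pdfD(2)]
  have [measurable]: "T \<in> borel_measurable borel" unfolding T_def[abs_def]
    by (intro borel_measurable_Pair) measurable
  have T_M [measurable]: "T \<in> borel_measurable M" unfolding M_def by simp
  have inner_T: "u \<bullet> T x = fst u * x + snd u * x\<^sup>2 - k u" for u x
    by (simp add: T_def k_def inner_prod_def algebra_simps)
  have Z: "Z u = ennreal (exp (- k u)) * laplace f u" for u
  proof -
    have "Z u = (\<integral>\<^sup>+x. ennreal (f x) * ennreal (exp (u \<bullet> T x)) \<partial>lborel)"
      unfolding Z_def M_def by (rule nn_integral_density) auto
    also have "\<dots> = (\<integral>\<^sup>+x. ennreal (exp (- k u)) * ennreal (f x * exp (fst u * x + snd u * x\<^sup>2)) \<partial>lborel)"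
      using nn by (intro nn_integral_cong)
        (simp add: inner_T ennreal_mult[symmetric] exp_diff exp_minus field_simps)
    also have "\<dots> = ennreal (exp (- k u)) * laplace f u"
      unfolding laplace_def by (rule nn_integral_cmult) measurable
    finally show ?thesis .
  qed
  have Dom: "Dom_psi f = {u. Z u < \<infinity>}"
    by (auto simp: Dom_psi_iff Z ennreal_mult_less_top)
  \<comment> \<open>Such an inequality passes from \<open>f\<close> to \<open>h\<close> by absolute
    continuity. Its left side has \<open>h\<close>-mean 0, so it vanishes wherever \<open>h\<close>
    is positive, almost everywhere; its zero set being null, \<open>h\<close> would have no
    mass.\<close>
  have nd: "\<not> (AE x in M. u \<bullet> T x \<le> 0)" if "u \<noteq> 0" for u
  proof
    assume "AE x in M. u \<bullet> T x \<le> 0"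
    then have "AE x in lborel. 0 < f x \<longrightarrow> u \<bullet> T x \<le> 0"
      unfolding M_def by (simp add: AE_density)
    moreover have "AE x in lborel. f x = 0 \<longrightarrow> h x = 0"
      using d by (simp add: KL_defined_iff[OF hp f])
    ultimately have nonneg: "AE x in lborel. 0 \<le> - (h x * (u \<bullet> T x))"
      by eventually_elim (metis nn less_eq_real_def mult_nonneg_nonpos mult_zero_left neg_0_le_iff_le)
    have "has_bochner_integral lborel
        (\<lambda>x. k u * h x - (fst u * (x * h x) + snd u * (x\<^sup>2 * h x)))
        (k u * 1 - (fst u * m + snd u * (v + m\<^sup>2)))"
      using vs is_pdfD(3)[OF hp] unfolding variance_shift_def
      by (intro has_bochner_integral_add has_bochner_integral_diff has_bochner_integral_mult_right) auto
    then have hb: "has_bochner_integral lborel (\<lambda>x. - (h x * (u \<bullet> T x))) 0"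
      by (simp add: inner_T k_def algebra_simps)
    then have "AE x in lborel. - (h x * (u \<bullet> T x)) = 0"
      using integral_nonneg_eq_0_iff_AE[OF _ nonneg] by (simp add: has_bochner_integral_iff)
    moreover have "AE x in lborel. u \<bullet> T x \<noteq> 0"
      using AE_quadratic_neq_0[of "fst u" "snd u" "- k u"] that
      by (simp add: inner_T prod_eq_iff)
    ultimately have "AE x in lborel. ennreal (h x) = 0" by eventually_elim simp
    then have "(\<integral>\<^sup>+x. ennreal (h x) \<partial>lborel) = 0"
      by (subst nn_integral_0_iff_AE) auto
    with hp show False by (simp add: is_pdf_def)
  qed
  obtain l where min: "\<And>u. Z l \<le> Z u"
    using nn_integral_exp_inner_attains_min[OF T_M nd] unfolding Z_def by blast
  \<comment> \<open>At 0 the integral is the total mass of \<open>f\<close>, so the minimum is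
    finite and the minimizer lies in the open domain.\<close>
  have "Z 0 < \<infinity>" using f by (simp add: Z laplace_def is_pdf_def k_def)
  then have "Z l < \<infinity>" using min[of 0] by (meson order.strict_trans1)
  then have l: "l \<in> Dom_psi f" by (simp add: Dom)
  have stat: "has_bochner_integral M (\<lambda>x. exp (l \<bullet> T x) * (b \<bullet> T x)) 0" for b
    using exp_inner_moment_stationary[OF T_M, of l b] op \<open>Z l < \<infinity>\<close> min
    unfolding Dom Z_def by blast
  define c where "c = exp (k l - real_of_ereal (psi f l))"
  have t: "tilted f l x = c * (f x * exp (l \<bullet> T x))" for x
    by (simp add: tilted_def c_def inner_T exp_add exp_diff field_simps)
  have "has_bochner_integral lborel (\<lambda>x. c * (f x * (exp (l \<bullet> T x) * (b \<bullet> T x)))) (c * 0)" for b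
    using stat[of b] nn unfolding M_def has_bochner_integral_iff
    by (simp add: integrable_density integral_density)
  then have T0: "has_bochner_integral lborel (\<lambda>x. tilted f l x * (b \<bullet> T x)) 0" for b
    by (simp add: t mult_ac)
  have one: "has_bochner_integral lborel (tilted f l) 1"
    by (rule is_pdfD(3)[OF is_pdf_tilted[OF f l]])
  \<comment> \<open>Adding \<open>k b\<close> times the total mass undoes the centring; the two
    coordinate directions then give the two constraints.\<close>
  have "has_bochner_integral lborel (\<lambda>x. tilted f l x * (b \<bullet> T x) + k b * tilted f l x) (0 + k b * 1)" for b
    by (intro has_bochner_integral_add has_bochner_integral_mult_right T0 one)
  then have "has_bochner_integral lborel (\<lambda>x. (fst b * x + snd b * x\<^sup>2) * tilted f l x) (k b)" for b
    by (simp add: inner_T algebra_simps)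
  from this[of "(1, 0)"] this[of "(0, 1)"] have "variance_shift m v (tilted f l)"
    by (simp add: variance_shift_def k_def)
  with l show ?thesis by blast
qed

section \<open>Form, characterization and existence of the optimum\<close>

text \<open>Existence is conditioned on a feasible density because a pdf with the prescribed moments
  may charge the zero set of \<open>f\<close>: for \<open>f\<close> uniform on the unit interval and
  \<open>V\<close> large, every such pdf does, and there is no competitor.\<close>

theorem proposition2p3:
  fixes M :: "'a measure" and X :: "'a \<Rightarrow> real" and f :: "real \<Rightarrow> real" and V :: real
  assumes "prob_space M"
    and "is_pdf f"
    and "distributed M lborel X (\<lambda>x. ennreal (f x))"
    and "\<exists>fm. is_pdf fm \<and> variance_shift (prob_space.expectation M X) V fm"
    and "open (Dom_psi f)"
  shows "(\<forall>g. optimal_density f (prob_space.expectation M X) V g \<longrightarrow>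
            (\<exists>l\<in>Dom_psi f. variance_shift (prob_space.expectation M X) V (tilted f l) \<and>
               (AE x in lborel. g x = tilted f l x)))
       \<and> (\<forall>l\<in>Dom_psi f. variance_shift (prob_space.expectation M X) V (tilted f l) \<longrightarrow>
            (\<forall>g. optimal_density f (prob_space.expectation M X) V g \<longleftrightarrow>
               is_pdf g \<and> (AE x in lborel. g x = tilted f l x)))
       \<and> ((\<exists>fm. feasible f (prob_space.expectation M X) V fm) \<longrightarrow>
            (\<exists>l\<in>Dom_psi f. variance_shift (prob_space.expectation M X) V (tilted f l) \<and>
               optimal_density f (prob_space.expectation M X) V (tilted f l)))"
proof -
  note f = assms(2) and op = assms(5)
  define m where "m = prob_space.expectation M X"
  have iff: "optimal_density f m V g \<longleftrightarrow> is_pdf g \<and> (AE x in lborel. g x = tilted f l x)"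
    if "l \<in> Dom_psi f" "variance_shift m V (tilted f l)" for l g
    using optimal_density_iff_tilted[OF f that] .
  have ex: "\<exists>l\<in>Dom_psi f. variance_shift m V (tilted f l)" if "feasible f m V h" for h
    using exists_tilted_variance_shift[OF f that op] .
  have opt: "optimal_density f m V (tilted f l)"
    if "l \<in> Dom_psi f" "variance_shift m V (tilted f l)" for l
    using iff[OF that] is_pdf_tilted[OF f that(1)] by simp
  show ?thesis
    unfolding m_def[symmetric]
    using iff ex opt by (meson optimal_density_def)
qed

end
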